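(* Let $k\ge 2$ be an integer, $a\in\mathbb{R}$ a constant, $I=[x_j,x_{j+1}]$ with $x_j<x_{j+1}$, and set $\Delta x=x_{j+1}-x_j$ and $m_i(x)=\big(\tfrac{x-x_j}{\Delta x}\big)^i$. Consider on $\mathbb{P}^k$ (polynomials of degree at most $k$ on $I$) the linear forms $$\langle\theta_0,u\rangle=u(x_j),\quad \langle\theta_1,u\rangle=u(x_{j+1}),\quad \langle\theta_{l+2},u\rangle=\int_I m_l(x)u(x)\,dx\quad (0\le l\le k-2),$$ and let $\{\varphi_q\}_{q=0}^k\subset\mathbb{P}^k$ be the dual basis, $\langle\theta_l,\varphi_q\rangle=\delta_{lq}$. Let $u_h(x)=\sum_{q=0}^k u_q\varphi_q(x)$, $U=(u_0,\dots,u_k)^T$, let $\mathtt{M}$ be the mass matrix $\mathtt{M}_{l\kappa}=\int_I\varphi_l\varphi_\kappa\,dx$, and let $F=(F_0,\dots,F_k)^T$ with $F_\kappa=\int_I a\,\varphi_\kappa\,\frac{du_h}{dx}\,dx$. Then $$(\mathtt{M}^{-1}F)_0=a\,\frac{du_h}{dx}(x_j),\qquad (\mathtt{M}^{-1}F)_1=a\,\frac{du_h}{dx}(x_{j+1}),$$ $$(\mathtt{M}^{-1}F)_{l+2}=\int_I a\,m_l(x)\,\frac{du_h}{dx}(x)\,dx\qquad (0\le l\le k-2).$$ Consequently, the discontinuous Galerkin system $\mathtt{M}\frac{dU}{dt}+F=0$ in $I$ is equivalent to the PamPa system $$\frac{du_0}{dt}+a\frac{du_h}{dx}(x_j)=0,\quad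 \frac{du_1}{dt}+a\frac{du_h}{dx}(x_{j+1})=0,\quad \frac{du_{l+2}}{dt}+\int_I a\,m_l\frac{du_h}{dx}\,dx=0\ \ (0\le l\le k-2).$$
   Context: The equation being discretised is the scalar linear advection equation $u_t+au_x=0$ with constant $a$. The unknowns $u_q=u_q(t)$ are the degrees of freedom in the element $I$: two end-point values and $k-1$ moments. The PamPa (Point-Average-Moment) scheme evolves the point values and the moments by the last displayed system. *)

theory Defs
  imports "HOL-Analysis.Analysis" "Jordan_Normal_Form.Gauss_Jordan_Elimination"
begin

unbundle no vec_syntax

text \<open>
  The element is \<open>I = {xl..xr}\<close> with \<open>xl < xr\<close>.  As \<open>I\<close> is infinite, polynomial
  functions on \<open>I\<close> of degree at most \<open>k\<close> are identified with polynomials \<open>p\<close> with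
  \<open>degree p \<le> k\<close>, and \<open>d/dx\<close> with \<^const>\<open>pderiv\<close>.
\<close>

definition moment_weight :: "real \<Rightarrow> real \<Rightarrow> nat \<Rightarrow> real \<Rightarrow> real" where
  "moment_weight xl xr i x = ((x - xl) / (xr - xl)) ^ i"

fun dof :: "real \<Rightarrow> real \<Rightarrow> nat \<Rightarrow> real poly \<Rightarrow> real" where
  "dof xl xr 0 u = poly u xl"
| "dof xl xr (Suc 0) u = poly u xr"
| "dof xl xr (Suc (Suc l)) u = integral {xl..xr} (\<lambda>x. moment_weight xl xr l x * poly u x)"

definition dual_basis :: "nat \<Rightarrow> real \<Rightarrow> real \<Rightarrow> (nat \<Rightarrow> real poly) \<Rightarrow> bool" where
  "dual_basis k xl xr \<phi> \<longleftrightarrow>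
     (\<forall>q\<le>k. degree (\<phi> q) \<le> k) \<and>
     (\<forall>l\<le>k. \<forall>q\<le>k. dof xl xr l (\<phi> q) = (if l = q then 1 else 0))"

definition u_h :: "nat \<Rightarrow> (nat \<Rightarrow> real poly) \<Rightarrow> real vec \<Rightarrow> real poly" where
  "u_h k \<phi> U = (\<Sum>q\<le>k. Polynomial.smult (U $ q) (\<phi> q))"

definition mass_matrix :: "nat \<Rightarrow> real \<Rightarrow> real \<Rightarrow> (nat \<Rightarrow> real poly) \<Rightarrow> real mat" where
  "mass_matrix k xl xr \<phi> = Matrix.mat (k + 1) (k + 1)
     (\<lambda>(l, \<kappa>). integral {xl..xr} (\<lambda>x. poly (\<phi> l) x * poly (\<phi> \<kappa>) x))"

definition flux_vector ::
  "nat \<Rightarrow> real \<Rightarrow> real \<Rightarrow> real \<Rightarrow> (nat \<Rightarrow> real poly) \<Rightarrow> real vec \<Rightarrow> real vec" where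
  "flux_vector k a xl xr \<phi> U = Matrix.vec (k + 1)
     (\<lambda>\<kappa>. integral {xl..xr} (\<lambda>x. a * poly (\<phi> \<kappa>) x * poly (pderiv (u_h k \<phi> U)) x))"

text \<open>
  \<^typ>\<open>real vec\<close> carries no norm, so the time derivative of \<open>U\<close> is taken componentwise.
  At an end point of the time interval \<open>T\<close> it is one-sided.
\<close>

definition has_vec_deriv ::
  "nat \<Rightarrow> (real \<Rightarrow> real vec) \<Rightarrow> real vec \<Rightarrow> real set \<Rightarrow> real \<Rightarrow> bool" where
  "has_vec_deriv n U dU T t \<longleftrightarrow> dU \<in> carrier_vec n \<and>
     (\<forall>q<n. ((\<lambda>s. U s $ q) has_real_derivative dU $ q) (at t within T))"

definition solves_DG ::
  "nat \<Rightarrow> real \<Rightarrow> real \<Rightarrow> real \<Rightarrow> (nat \<Rightarrow> real poly) \<Rightarrow> real set \<Rightarrow> (real \<Rightarrow> real vec) \<Rightarrow> bool" where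
  "solves_DG k a xl xr \<phi> T U \<longleftrightarrow>
     (\<forall>t\<in>T. \<exists>dU. has_vec_deriv (k + 1) U dU T t \<and>
        mass_matrix k xl xr \<phi> *\<^sub>v dU + flux_vector k a xl xr \<phi> (U t) = 0\<^sub>v (k + 1))"

definition solves_PamPa ::
  "nat \<Rightarrow> real \<Rightarrow> real \<Rightarrow> real \<Rightarrow> (nat \<Rightarrow> real poly) \<Rightarrow> real set \<Rightarrow> (real \<Rightarrow> real vec) \<Rightarrow> bool" where
  "solves_PamPa k a xl xr \<phi> T U \<longleftrightarrow>
     (\<forall>t\<in>T. \<exists>dU. has_vec_deriv (k + 1) U dU T t \<and>
        dU $ 0 + a * poly (pderiv (u_h k \<phi> (U t))) xl = 0 \<and>
        dU $ 1 + a * poly (pderiv (u_h k \<phi> (U t))) xr = 0 \<and>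
        (\<forall>l\<le>k - 2. dU $ (l + 2) +
           integral {xl..xr}
             (\<lambda>x. a * moment_weight xl xr l x * poly (pderiv (u_h k \<phi> (U t))) x) = 0))"

end

theory Submission
  imports Defs "Jordan_Normal_Form.Determinant"
begin

text \<open>
  The degrees of freedom are unisolvent: if they all vanish on a polynomial \<open>p\<close> of degree at
  most \<open>k\<close>, then \<open>p = (x - xl) (xr - x) r\<close> with \<open>degree r \<le> k - 2\<close>, and \<open>p\<close> is orthogonal to all
  polynomials of degree at most \<open>k - 2\<close>, in particular to \<open>r\<close>; thus \<open>(x - xl) (xr - x) r\<^sup>2\<close> has
  integral \<open>0\<close> and \<open>r = 0\<close> (\<open>dof_unisolvent\<close>).  Hence every polynomial of degree at most \<open>k\<close> is the
  combination of the dual basis whose coefficients are its own degrees of freedom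
  (\<open>dual_basis_expansion\<close>).

  The derivative \<open>du\<close> of \<open>u_h\<close> has degree at most \<open>k\<close>, so this expansion applies to it.  Testing it
  against the basis gives \<open>F = M W\<close>, where \<open>W\<close> consists of the degrees of freedom of \<open>du\<close> times \<open>a\<close>
  (\<open>flux_vector_eq\<close>).  The mass matrix is the Gram matrix of linearly independent polynomials, so it
  has trivial kernel (\<open>mass_matrix_kernel\<close>) and \<open>M\<inverse> F = W\<close>, which is the vector of spatial
  terms of the PamPa scheme.  The equivalence of the two systems is then the equivalence of
  \<open>M (dU + W) = 0\<close> with \<open>dU + W = 0\<close>.
\<close>

section \<open>Unisolvence of the degrees of freedom\<close>

text \<open>A nonzero polynomial cannot vanish throughout a nondegenerate interval, so a positive weight
  turns the vanishing of a single weighted integral of the square into \<open>r = 0\<close>.\<close>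

lemma integral_weighted_square_eq_0:
  fixes w r :: "real poly"
  assumes lr: "xl < xr"
    and pos: "\<And>x. xl < x \<Longrightarrow> x < xr \<Longrightarrow> poly w x > 0"
    and int0: "integral {xl..xr} (\<lambda>x. poly w x * (poly r x)\<^sup>2) = 0"
  shows "r = 0"
proof (rule ccontr)
  assume "r \<noteq> 0"
  have "poly r x = 0" if x: "x \<in> {xl<..<xr}" for x
  proof -
    let ?f = "\<lambda>x. poly w x * (poly r x)\<^sup>2"
    have cont: "continuous_on {xl..xr} ?f" by (intro continuous_intros)
    \<comment> \<open>The weight may vanish at the end points; there nonnegativity is a limit statement.\<close>
    have "closure {xl<..<xr} = {xl..xr}" using lr by simp
    moreover have "?f y \<ge> 0" if "y \<in> {xl<..<xr}" for y
      using pos[of y] that by (simp add: less_imp_le)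
    ultimately have nonneg: "?f y \<ge> 0" if "y \<in> {xl..xr}" for y
      using continuous_ge_on_closure[of "{xl<..<xr}" ?f y 0] cont that by simp
    have "(?f has_integral 0) {xl..xr}"
      using int0 integrable_integral[OF integrable_continuous_real[OF cont]] by simp
    then have "(?f has_integral 0) (cbox xl xr)" by simp
    then have "?f x = 0"
      using has_integral_0_cbox_imp_0[of xl xr ?f x] cont nonneg x lr by simp
    then show ?thesis using pos[of x] x by auto
  qed
  then have "{xl<..<xr} \<subseteq> {x. poly r x = 0}" by auto
  then have "finite {xl<..<xr}" using poly_roots_finite[OF \<open>r \<noteq> 0\<close>] finite_subset by blast
  then show False using lr infinite_Ioo by blast
qed

lemma dof_add: "dof xl xr l (p + q) = dof xl xr l p + dof xl xr l q"
proof (cases "(xl, xr, l, p)" rule: dof.cases)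
  case (3 xl' xr' m u)
  have "(\<lambda>x. moment_weight xl xr m x * poly v x) integrable_on {xl..xr}" for v
    unfolding moment_weight_def divide_inverse
    by (intro integrable_continuous_real continuous_intros)
  then show ?thesis using 3 by (simp add: distrib_left integral_add)
qed auto

lemma dof_smult: "dof xl xr l (Polynomial.smult c p) = c * dof xl xr l p"
  by (cases "(xl, xr, l, p)" rule: dof.cases) (auto simp: mult.left_commute)

lemma dof_0: "dof xl xr l 0 = 0"
  using dof_smult[of xl xr l 0 0] by simp

lemma dof_sum: "dof xl xr l (\<Sum>i\<in>A. f i) = (\<Sum>i\<in>A. dof xl xr l (f i))"
  by (induction A rule: infinite_finite_induct) (simp_all add: dof_0 dof_add)

text \<open>The moments determine the integral against any polynomial \<open>r\<close>: rewritten in the variable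
  \<open>(x - xl) / (xr - xl)\<close>, \<open>r\<close> is a combination of the weights up to its own degree.\<close>

lemma integral_poly_mult_eq_moments:
  fixes r :: "real poly"
  assumes "xl < xr"
  obtains c where "\<And>p. integral {xl..xr} (\<lambda>x. poly p x * poly r x)
    = (\<Sum>i\<le>degree r. c i * dof xl xr (i + 2) p)"
proof -
  define s where "s = pcompose r [:xl, xr - xl:]"
  have deg: "degree s = degree r" using assms by (simp add: s_def degree_pcompose)
  have r: "poly r x = (\<Sum>i\<le>degree r. coeff s i * moment_weight xl xr i x)" for x
  proof -
    have "poly r x = poly s ((x - xl) / (xr - xl))"
      using assms by (simp add: s_def poly_pcompose)
    then show ?thesis by (simp add: poly_altdef deg moment_weight_def)
  qed
  have "integral {xl..xr} (\<lambda>x. poly p x * poly r x)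
      = (\<Sum>i\<le>degree r. coeff s i * dof xl xr (i + 2) p)" for p
  proof -
    have int: "(\<lambda>x. coeff s i * (moment_weight xl xr i x * poly p x)) integrable_on {xl..xr}" for i
      unfolding moment_weight_def divide_inverse
      by (intro integrable_continuous_real continuous_intros)
    have "integral {xl..xr} (\<lambda>x. poly p x * poly r x)
        = integral {xl..xr} (\<lambda>x. \<Sum>i\<le>degree r. coeff s i * (moment_weight xl xr i x * poly p x))"
      by (simp add: r sum_distrib_left mult_ac)
    also have "\<dots> = (\<Sum>i\<le>degree r. coeff s i * dof xl xr (i + 2) p)"
      by (subst integral_sum) (use int in simp_all)
    finally show ?thesis .
  qed
  then show ?thesis by (rule that)
qed

lemma dof_unisolvent:
  fixes p :: "real poly"
  assumes "k \<ge> 2" and lr: "xl < xr" and deg: "degree p \<le> k"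
    and dof0: "\<And>l. l \<le> k \<Longrightarrow> dof xl xr l p = 0"
  shows "p = 0"
proof (rule ccontr)
  assume "p \<noteq> 0"
  have "poly p xl = 0" "poly p xr = 0" using dof0[of 0] dof0[of 1] \<open>k \<ge> 2\<close> by simp_all
  then obtain s where s: "p = [:- xl, 1:] * s" by (auto simp: poly_eq_0_iff_dvd elim: dvdE)
  with \<open>poly p xr = 0\<close> lr have "poly s xr = 0" by simp
  then obtain t where t: "s = [:- xr, 1:] * t" by (auto simp: poly_eq_0_iff_dvd elim: dvdE)
  define w where "w = - ([:- xl, 1:] * [:- xr, 1:])"
  define r where "r = - t"
  have p: "p = w * r" unfolding s t w_def r_def by (simp only: mult.assoc minus_mult_minus)
  with \<open>p \<noteq> 0\<close> have "w \<noteq> 0" "r \<noteq> 0" by auto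
  have "degree w = 2" unfolding w_def degree_minus by (subst degree_mult_eq) auto
  then have "degree r \<le> k - 2"
    using deg degree_mult_eq[OF \<open>w \<noteq> 0\<close> \<open>r \<noteq> 0\<close>] p by simp
  moreover obtain c where "integral {xl..xr} (\<lambda>x. poly p x * poly r x)
      = (\<Sum>i\<le>degree r. c i * dof xl xr (i + 2) p)"
    using integral_poly_mult_eq_moments[OF lr, of r] by metis
  ultimately have "integral {xl..xr} (\<lambda>x. poly p x * poly r x) = 0"
    using dof0 \<open>k \<ge> 2\<close> by (simp del: dof.simps)
  then have "integral {xl..xr} (\<lambda>x. poly w x * (poly r x)\<^sup>2) = 0"
    by (simp add: p power2_eq_square mult.assoc)
  moreover have "poly w x > 0" if "xl < x" "x < xr" for x
  proof -
    have "poly w x = (x - xl) * (xr - x)" by (simp add: w_def algebra_simps)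
    then show ?thesis using that by simp
  qed
  ultimately have "r = 0" using integral_weighted_square_eq_0[OF lr] by blast
  with \<open>r \<noteq> 0\<close> show False by simp
qed

section \<open>Expansion in the dual basis\<close>

lemma dof_u_h:
  assumes "dual_basis k xl xr \<phi>" and "l \<le> k"
  shows "dof xl xr l (u_h k \<phi> V) = V $ l"
proof -
  have "dof xl xr l (u_h k \<phi> V) = (\<Sum>q\<le>k. V $ q * (if l = q then 1 else 0))"
    using assms unfolding u_h_def dof_sum dof_smult dual_basis_def by (intro sum.cong) auto
  also have "\<dots> = V $ l" using assms(2) by (simp add: if_distrib cong: if_cong)
  finally show ?thesis .
qed

lemma degree_u_h:
  assumes "dual_basis k xl xr \<phi>"
  shows "degree (u_h k \<phi> V) \<le> k"
  using assms unfolding u_h_def dual_basis_def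
  by (intro degree_sum_le) (auto intro: order_trans[OF degree_smult_le])

text \<open>Both sides have the same degrees of freedom, so unisolvence identifies them.\<close>

lemma dual_basis_expansion:
  assumes "k \<ge> 2" and "xl < xr" and basis: "dual_basis k xl xr \<phi>" and "degree p \<le> k"
  shows "u_h k \<phi> (Matrix.vec (k + 1) (\<lambda>q. dof xl xr q p)) = p"
proof -
  let ?V = "Matrix.vec (k + 1) (\<lambda>q. dof xl xr q p)"
  have "dof xl xr l (u_h k \<phi> ?V - p) = 0" if "l \<le> k" for l
    using dof_u_h[OF basis that, of ?V] that dof_add[of xl xr l "u_h k \<phi> ?V - p" p] by simp
  moreover have "degree (u_h k \<phi> ?V - p) \<le> k"
    using degree_u_h[OF basis] assms(4) by (rule degree_diff_le)
  ultimately have "u_h k \<phi> ?V - p = 0" using dof_unisolvent assms(1,2) by blast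
  then show ?thesis by simp
qed

section \<open>The mass matrix\<close>

lemma mass_matrix_carrier: "mass_matrix k xl xr \<phi> \<in> carrier_mat (k + 1) (k + 1)"
  by (simp add: mass_matrix_def)

lemma poly_u_h: "poly (u_h k \<phi> V) x = (\<Sum>q\<le>k. V $ q * poly (\<phi> q) x)"
  by (simp add: u_h_def poly_sum)

lemma mass_matrix_mult_vec:
  assumes "V \<in> carrier_vec (k + 1)" and "\<kappa> \<le> k"
  shows "(mass_matrix k xl xr \<phi> *\<^sub>v V) $ \<kappa>
    = integral {xl..xr} (\<lambda>x. poly (\<phi> \<kappa>) x * poly (u_h k \<phi> V) x)"
proof -
  have int: "(\<lambda>x. V $ q * (poly (\<phi> \<kappa>) x * poly (\<phi> q) x)) integrable_on {xl..xr}" for q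
    by (intro integrable_continuous_real continuous_intros)
  have "(mass_matrix k xl xr \<phi> *\<^sub>v V) $ \<kappa>
      = (\<Sum>q\<le>k. integral {xl..xr} (\<lambda>x. poly (\<phi> \<kappa>) x * poly (\<phi> q) x) * V $ q)"
    using assms
    by (simp add: mass_matrix_def scalar_prod_def atLeast0LessThan lessThan_Suc_atMost)
  also have "\<dots> = integral {xl..xr} (\<lambda>x. \<Sum>q\<le>k. V $ q * (poly (\<phi> \<kappa>) x * poly (\<phi> q) x))"
    by (subst integral_sum) (use int in \<open>simp_all add: mult.commute\<close>)
  also have "\<dots> = integral {xl..xr} (\<lambda>x. poly (\<phi> \<kappa>) x * poly (u_h k \<phi> V) x)"
    by (simp add: poly_u_h sum_distrib_left mult_ac)
  finally show ?thesis .
qed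

text \<open>If \<open>M V = 0\<close>, then \<open>v = u_h k \<phi> V\<close> is orthogonal to every basis function, hence to itself;
  so \<open>v = 0\<close>, and the entries of \<open>V\<close> are the degrees of freedom of \<open>v\<close>.\<close>

lemma mass_matrix_kernel:
  assumes lr: "xl < xr" and basis: "dual_basis k xl xr \<phi>"
    and V: "V \<in> carrier_vec (k + 1)"
    and MV: "mass_matrix k xl xr \<phi> *\<^sub>v V = 0\<^sub>v (k + 1)"
  shows "V = 0\<^sub>v (k + 1)"
proof -
  let ?v = "u_h k \<phi> V"
  have int: "(\<lambda>x. V $ q * (poly (\<phi> q) x * poly ?v x)) integrable_on {xl..xr}" for q
    by (intro integrable_continuous_real continuous_intros)
  have "integral {xl..xr} (\<lambda>x. (poly ?v x)\<^sup>2)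
      = integral {xl..xr} (\<lambda>x. \<Sum>q\<le>k. V $ q * (poly (\<phi> q) x * poly ?v x))"
    by (subst power2_eq_square, subst (2) poly_u_h) (simp add: sum_distrib_left mult_ac)
  also have "\<dots> = (\<Sum>q\<le>k. V $ q * (mass_matrix k xl xr \<phi> *\<^sub>v V) $ q)"
    by (subst integral_sum) (use int in \<open>simp_all add: mass_matrix_mult_vec[OF V]\<close>)
  also have "\<dots> = 0" by (simp add: MV)
  finally have "integral {xl..xr} (\<lambda>x. poly 1 x * (poly ?v x)\<^sup>2) = 0" by simp
  then have "?v = 0" using integral_weighted_square_eq_0[OF lr, of 1 ?v] by simp
  then have "V $ q = 0" if "q \<le> k" for q using dof_u_h[OF basis that, of V] by (simp add: dof_0)
  then show ?thesis using V by (intro eq_vecI) auto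
qed

lemma mass_matrix_inverse:
  assumes "xl < xr" and "dual_basis k xl xr \<phi>"
  obtains B where "mat_inverse (mass_matrix k xl xr \<phi>) = Some B" "B \<in> carrier_mat (k + 1) (k + 1)"
    "mass_matrix k xl xr \<phi> * B = 1\<^sub>m (k + 1)" "B * mass_matrix k xl xr \<phi> = 1\<^sub>m (k + 1)"
proof -
  let ?M = "mass_matrix k xl xr \<phi>"
  note M = mass_matrix_carrier[of k xl xr \<phi>]
  have "Determinant.det ?M \<noteq> 0"
    using det_0_iff_vec_prod_zero_field[OF M] mass_matrix_kernel[OF assms] by blast
  then have "?M \<in> Units (ring_mat TYPE(real) (k + 1) ())" by (rule det_non_zero_imp_unit[OF M])
  then have "mat_inverse ?M \<noteq> None" using mat_inverse(1)[OF M, where b = "()"] by blast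
  then obtain B where "mat_inverse ?M = Some B" by blast
  then show ?thesis using that mat_inverse(2)[OF M] by blast
qed

section \<open>Equivalence of the two schemes\<close>

definition pampa_flux :: "nat \<Rightarrow> real \<Rightarrow> real \<Rightarrow> real \<Rightarrow> (nat \<Rightarrow> real poly) \<Rightarrow> real vec \<Rightarrow> real vec" where
  "pampa_flux k a xl xr \<phi> U = Matrix.vec (k + 1) (\<lambda>q. a * dof xl xr q (pderiv (u_h k \<phi> U)))"

lemma pampa_flux_carrier: "pampa_flux k a xl xr \<phi> U \<in> carrier_vec (k + 1)"
  by (simp add: pampa_flux_def)

text \<open>Differentiation does not leave the space of polynomials of degree at most \<open>k\<close>, so the
  derivative of \<open>u_h\<close> equals its own expansion, and integrating this expansion against the basis
  functions is multiplication by the mass matrix.\<close>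

lemma flux_vector_eq:
  assumes "k \<ge> 2" and "xl < xr" and basis: "dual_basis k xl xr \<phi>"
  shows "flux_vector k a xl xr \<phi> U = mass_matrix k xl xr \<phi> *\<^sub>v pampa_flux k a xl xr \<phi> U"
proof (rule eq_vecI)
  let ?du = "pderiv (u_h k \<phi> U)"
  let ?V = "Matrix.vec (k + 1) (\<lambda>q. dof xl xr q (Polynomial.smult a ?du))"
  have "degree (Polynomial.smult a ?du) \<le> k"
    using degree_u_h[OF basis, of U] degree_smult_le[of a ?du] by (simp add: degree_pderiv)
  then have exp: "u_h k \<phi> ?V = Polynomial.smult a ?du" by (rule dual_basis_expansion[OF assms])
  have V: "pampa_flux k a xl xr \<phi> U = ?V" by (simp add: pampa_flux_def dof_smult)
  fix \<kappa> assume "\<kappa> < dim_vec (mass_matrix k xl xr \<phi> *\<^sub>v pampa_flux k a xl xr \<phi> U)"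
  then have "\<kappa> \<le> k" by (simp add: mass_matrix_def)
  then have "(mass_matrix k xl xr \<phi> *\<^sub>v ?V) $ \<kappa>
      = integral {xl..xr} (\<lambda>x. poly (\<phi> \<kappa>) x * poly (Polynomial.smult a ?du) x)"
    by (subst mass_matrix_mult_vec) (simp_all only: exp vec_carrier)
  then show "flux_vector k a xl xr \<phi> U $ \<kappa>
      = (mass_matrix k xl xr \<phi> *\<^sub>v pampa_flux k a xl xr \<phi> U) $ \<kappa>"
    using \<open>\<kappa> \<le> k\<close> unfolding V by (simp add: flux_vector_def mult_ac)
qed (simp add: flux_vector_def mass_matrix_def)

lemma pampa_flux_nth:
  assumes "k \<ge> 2"
  shows "pampa_flux k a xl xr \<phi> U $ 0 = a * poly (pderiv (u_h k \<phi> U)) xl"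
    and "pampa_flux k a xl xr \<phi> U $ 1 = a * poly (pderiv (u_h k \<phi> U)) xr"
    and "l \<le> k - 2 \<Longrightarrow> pampa_flux k a xl xr \<phi> U $ (l + 2) =
      integral {xl..xr} (\<lambda>x. a * moment_weight xl xr l x * poly (pderiv (u_h k \<phi> U)) x)"
proof -
  let ?du = "pderiv (u_h k \<phi> U)"
  show "pampa_flux k a xl xr \<phi> U $ 0 = a * poly ?du xl"
    and "pampa_flux k a xl xr \<phi> U $ 1 = a * poly ?du xr"
    using assms by (simp_all add: pampa_flux_def)
  have "dof xl xr (l + 2) ?du = integral {xl..xr} (\<lambda>x. moment_weight xl xr l x * poly ?du x)"
    by simp
  then show "pampa_flux k a xl xr \<phi> U $ (l + 2) =
      integral {xl..xr} (\<lambda>x. a * moment_weight xl xr l x * poly ?du x)" if "l \<le> k - 2"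
    using assms that by (simp add: pampa_flux_def mult.assoc)
qed

lemma add_pampa_flux_eq_0_iff:
  assumes k: "k \<ge> 2" and V: "V \<in> carrier_vec (k + 1)"
  shows "V + pampa_flux k a xl xr \<phi> U = 0\<^sub>v (k + 1) \<longleftrightarrow>
    V $ 0 + a * poly (pderiv (u_h k \<phi> U)) xl = 0 \<and>
    V $ 1 + a * poly (pderiv (u_h k \<phi> U)) xr = 0 \<and>
    (\<forall>l\<le>k - 2. V $ (l + 2) +
       integral {xl..xr} (\<lambda>x. a * moment_weight xl xr l x * poly (pderiv (u_h k \<phi> U)) x) = 0)"
proof -
  let ?W = "pampa_flux k a xl xr \<phi> U"
  have "V + ?W = 0\<^sub>v (k + 1) \<longleftrightarrow> (\<forall>q<k + 1. V $ q + ?W $ q = 0)"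
    using V pampa_flux_carrier[of k a xl xr \<phi> U] by (auto simp: vec_eq_iff)
  also have "\<dots> \<longleftrightarrow> V $ 0 + ?W $ 0 = 0 \<and> V $ 1 + ?W $ 1 = 0 \<and>
      (\<forall>l\<le>k - 2. V $ (l + 2) + ?W $ (l + 2) = 0)" (is "?L \<longleftrightarrow> ?R")
  proof
    assume ?L
    then show ?R using k by auto
  next
    assume R: ?R
    show ?L
    proof (intro allI impI)
      fix q assume "q < k + 1"
      then consider "q = 0" | "q = 1" | l where "q = l + 2" "l \<le> k - 2"
        by (metis One_nat_def Suc_1 add.commute add_2_eq_Suc diff_le_mono diff_add_inverse2
            less_Suc_eq_le not0_implies_Suc Suc_eq_plus1)
      then show "V $ q + ?W $ q = 0" using R by cases auto
    qed
  qed
  finally show ?thesis using pampa_flux_nth[OF k, where a = a and xl = xl and xr = xr and \<phi> = \<phi> and U = U] by simp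
qed

text \<open>Since \<open>F = M W\<close>, the semi-discrete residual is \<open>M (V + W)\<close>, and \<open>M\<close> has trivial kernel.\<close>

lemma mass_matrix_residual_eq_0_iff:
  assumes "k \<ge> 2" and "xl < xr" and "dual_basis k xl xr \<phi>" and V: "V \<in> carrier_vec (k + 1)"
  shows "mass_matrix k xl xr \<phi> *\<^sub>v V + flux_vector k a xl xr \<phi> U = 0\<^sub>v (k + 1) \<longleftrightarrow>
    V + pampa_flux k a xl xr \<phi> U = 0\<^sub>v (k + 1)"
proof -
  let ?M = "mass_matrix k xl xr \<phi>" and ?W = "pampa_flux k a xl xr \<phi> U"
  note carrier = mass_matrix_carrier[of k xl xr \<phi>] pampa_flux_carrier[of k a xl xr \<phi> U]
  have "?M *\<^sub>v V + flux_vector k a xl xr \<phi> U = ?M *\<^sub>v (V + ?W)"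
    using mult_add_distrib_mat_vec[OF carrier(1) V carrier(2)] flux_vector_eq[OF assms(1-3)] by simp
  moreover have "?M *\<^sub>v 0\<^sub>v (k + 1) = 0\<^sub>v (k + 1)"
    using carrier(1) by (intro eq_vecI) (auto simp: scalar_prod_def)
  ultimately show ?thesis
    using mass_matrix_kernel[OF assms(2,3), of "V + ?W"] add_carrier_vec[OF V carrier(2)] by auto
qed

theorem mainTheorem1:
  fixes k :: nat and a xl xr :: real and \<phi> :: "nat \<Rightarrow> real poly"
  assumes "k \<ge> 2" and "xl < xr" and "dual_basis k xl xr \<phi>"
  shows "invertible_mat (mass_matrix k xl xr \<phi>) \<and>
    (\<forall>U \<in> carrier_vec (k + 1).
       let du = pderiv (u_h k \<phi> U);
           MF = the (mat_inverse (mass_matrix k xl xr \<phi>)) *\<^sub>v flux_vector k a xl xr \<phi> U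
       in MF $ 0 = a * poly du xl \<and>
          MF $ 1 = a * poly du xr \<and>
          (\<forall>l\<le>k - 2. MF $ (l + 2) =
             integral {xl..xr} (\<lambda>x. a * moment_weight xl xr l x * poly du x))) \<and>
    (\<forall>T U. is_interval T \<longrightarrow> interior T \<noteq> {} \<longrightarrow> (\<forall>t\<in>T. U t \<in> carrier_vec (k + 1)) \<longrightarrow>
       (solves_DG k a xl xr \<phi> T U \<longleftrightarrow> solves_PamPa k a xl xr \<phi> T U))"
proof (intro conjI ballI allI impI)
  let ?M = "mass_matrix k xl xr \<phi>"
  note carrier = mass_matrix_carrier[of k xl xr \<phi>]
  obtain B where B: "mat_inverse ?M = Some B" "B \<in> carrier_mat (k + 1) (k + 1)"
    "?M * B = 1\<^sub>m (k + 1)" "B * ?M = 1\<^sub>m (k + 1)"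
    using mass_matrix_inverse[OF assms(2,3)] .
  show "invertible_mat ?M"
    using B carrier unfolding invertible_mat_def inverts_mat_def by auto
  fix U :: "real vec"
  let ?W = "pampa_flux k a xl xr \<phi> U"
  have "B *\<^sub>v flux_vector k a xl xr \<phi> U = (B * ?M) *\<^sub>v ?W"
    using flux_vector_eq[OF assms] assoc_mult_mat_vec[OF B(2) carrier pampa_flux_carrier] by simp
  then have MF: "the (mat_inverse ?M) *\<^sub>v flux_vector k a xl xr \<phi> U = ?W"
    using B(1,4) pampa_flux_carrier[of k a xl xr \<phi> U] by simp
  show "let du = pderiv (u_h k \<phi> U);
           MF = the (mat_inverse ?M) *\<^sub>v flux_vector k a xl xr \<phi> U
       in MF $ 0 = a * poly du xl \<and>
          MF $ 1 = a * poly du xr \<and>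
          (\<forall>l\<le>k - 2. MF $ (l + 2) =
             integral {xl..xr} (\<lambda>x. a * moment_weight xl xr l x * poly du x))"
    unfolding Let_def MF using pampa_flux_nth[OF assms(1)] by blast
next
  fix T :: "real set" and U :: "real \<Rightarrow> real vec"
  have "has_vec_deriv (k + 1) U dU T t \<and>
        mass_matrix k xl xr \<phi> *\<^sub>v dU + flux_vector k a xl xr \<phi> (U t) = 0\<^sub>v (k + 1) \<longleftrightarrow>
      has_vec_deriv (k + 1) U dU T t \<and>
        dU $ 0 + a * poly (pderiv (u_h k \<phi> (U t))) xl = 0 \<and>
        dU $ 1 + a * poly (pderiv (u_h k \<phi> (U t))) xr = 0 \<and>
        (\<forall>l\<le>k - 2. dU $ (l + 2) +
           integral {xl..xr}
             (\<lambda>x. a * moment_weight xl xr l x * poly (pderiv (u_h k \<phi> (U t))) x) = 0)"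
    for dU t
    using mass_matrix_residual_eq_0_iff[OF assms, where V = dU and a = a and U = "U t"]
      add_pampa_flux_eq_0_iff[OF assms(1), where V = dU and a = a and xl = xl and xr = xr
        and \<phi> = \<phi> and U = "U t"]
    unfolding has_vec_deriv_def by blast
  then show "solves_DG k a xl xr \<phi> T U \<longleftrightarrow> solves_PamPa k a xl xr \<phi> T U"
    unfolding solves_DG_def solves_PamPa_def by simp
qed

end
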